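(* The inconsistency measure $I'_M$ is ind-decomposable. That is, for all knowledge bases $K_1,\ldots,K_n$ ($n\ge 1$) such that (i) $\mathrm{MUSes}(K_1\cup\cdots\cup K_n)=\mathrm{MUSes}(K_1)\oplus\cdots\oplus \mathrm{MUSes}(K_n)$ and (ii) $\mathrm{unfree}(K_i)\cap \mathrm{unfree}(K_j)=\emptyset$ for all $1\le i\ne j\le n$, one has $$I'_M(K_1\cup\cdots\cup K_n)=I'_M(K_1)+\cdots+I'_M(K_n).$$
   Context: Formulae are those of classical propositional logic over a finite set $\mathcal P$ of propositional symbols; $\vdash$ is classical deduction. A knowledge base (KB) is a finite set of formulae; a set of formulae $X$ is inconsistent iff $X\vdash\bot$. A MUS of a KB $K$ is a set $M\subseteq K$ with $M\vdash\bot$ such that no proper subset of $M$ is inconsistent; $\mathrm{MUSes}(K)$ is the set of all MUSes of $K$. An MSS of $K$ is a set $M\subseteq K$ that is consistent and such that $M\cup\{\alpha\}\vdash\bot$ for every $\alpha\in K\setminus M$; $\mathrm{MSSes}(K)$ is the set of all of them. $\mathrm{selfC}(K)=\{\alpha\in K\mid \{\alpha\}\vdash\bot\}$. $\mathrm{free}(K)$ is the set of $\alpha\in K$ belonging to no MUS of $K$, and $\mathrm{unfree}(K)=K\setminus\mathrm{free}(K)$. $C=A_1\oplus\cdots\oplus A_n$ means that $C=A_1\cup\cdots\cup A_n$ and the $A_i$ are pairwise disjoint (possibly empty). The MUS-graph $\mathcal G_{MUS}(K)$ is the undirected graph with vertex set $\mathrm{MUSes}(K)$ in which $\{M,M'\}$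 is an edge iff $M\cap M'\neq\emptyset$. The MUS-decomposition of $K$ is the set $\{K_1,\ldots,K_p\}$ such that $K=K_1\cup\cdots\cup K_p\cup\mathrm{free}(K)$ is a partition of $K$ (the $K_i$ are pairwise disjoint and disjoint from $\mathrm{free}(K)$) and $\mathrm{MUSes}(K_1),\ldots,\mathrm{MUSes}(K_p)$ are exactly the connected components (as vertex sets) of $\mathcal G_{MUS}(K)$; equivalently each $K_i$ is the union of the MUSes in one connected component. For a KB $K$ with MUS-decomposition $\{K_1,\ldots,K_p\}$, define $I'_M(K)=\sum_{i=1}^p|\mathrm{MSSes}(K_i)|+|\mathrm{selfC}(K)|$ if $K\vdash\bot$, and $I'_M(K)=0$ otherwise. *)

theory Defs
  imports "HOL-Library.Disjoint_Sets" "Graph_Theory.Graph_Theory"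
begin

subsection \<open>Classical propositional logic\<close>

datatype (atoms: 'p) form =
    Bot
  | Atom 'p
  | Neg "'p form"
  | Conj "'p form" "'p form"
  | Disj "'p form" "'p form"
  | Impl "'p form" "'p form"

text \<open>
  Natural deduction for classical logic.  Derivations may mention any atom of the type
  \<^typ>\<open>'p\<close>.  Allowing atoms beyond a given finite vocabulary does not change which formulae over
  that vocabulary are derivable from premises over it: replace every other atom by falsum
  throughout the derivation.
\<close>

inductive deriv :: "'p form set \<Rightarrow> 'p form \<Rightarrow> bool" (infix \<open>\<turnstile>\<close> 50) where
  Ax: "\<phi> \<in> \<Gamma> \<Longrightarrow> \<Gamma> \<turnstile> \<phi>"
| Classical: "insert (Neg \<phi>) \<Gamma> \<turnstile> Bot \<Longrightarrow> \<Gamma> \<turnstile> \<phi>"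
| NegI: "insert \<phi> \<Gamma> \<turnstile> Bot \<Longrightarrow> \<Gamma> \<turnstile> Neg \<phi>"
| NegE: "\<Gamma> \<turnstile> Neg \<phi> \<Longrightarrow> \<Gamma> \<turnstile> \<phi> \<Longrightarrow> \<Gamma> \<turnstile> Bot"
| ConjI: "\<Gamma> \<turnstile> \<phi> \<Longrightarrow> \<Gamma> \<turnstile> \<psi> \<Longrightarrow> \<Gamma> \<turnstile> Conj \<phi> \<psi>"
| ConjE1: "\<Gamma> \<turnstile> Conj \<phi> \<psi> \<Longrightarrow> \<Gamma> \<turnstile> \<phi>"
| ConjE2: "\<Gamma> \<turnstile> Conj \<phi> \<psi> \<Longrightarrow> \<Gamma> \<turnstile> \<psi>"
| DisjI1: "\<Gamma> \<turnstile> \<phi> \<Longrightarrow> \<Gamma> \<turnstile> Disj \<phi> \<psi>"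
| DisjI2: "\<Gamma> \<turnstile> \<psi> \<Longrightarrow> \<Gamma> \<turnstile> Disj \<phi> \<psi>"
| DisjE: "\<Gamma> \<turnstile> Disj \<phi> \<psi> \<Longrightarrow> insert \<phi> \<Gamma> \<turnstile> \<chi> \<Longrightarrow> insert \<psi> \<Gamma> \<turnstile> \<chi> \<Longrightarrow> \<Gamma> \<turnstile> \<chi>"
| ImplI: "insert \<phi> \<Gamma> \<turnstile> \<psi> \<Longrightarrow> \<Gamma> \<turnstile> Impl \<phi> \<psi>"
| ImplE: "\<Gamma> \<turnstile> Impl \<phi> \<psi> \<Longrightarrow> \<Gamma> \<turnstile> \<phi> \<Longrightarrow> \<Gamma> \<turnstile> \<psi>"

definition inconsistent :: "'p form set \<Rightarrow> bool" where
  "inconsistent X \<longleftrightarrow> X \<turnstile> Bot"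

definition knowledge_base :: "'p set \<Rightarrow> 'p form set \<Rightarrow> bool" where
  "knowledge_base P K \<longleftrightarrow> finite K \<and> (\<forall>\<alpha>\<in>K. atoms \<alpha> \<subseteq> P)"

subsection \<open>MUSes, MSSes, free and self-contradictory formulae\<close>

definition MUSes :: "'p form set \<Rightarrow> 'p form set set" where
  "MUSes K = {M. M \<subseteq> K \<and> inconsistent M \<and> (\<forall>M'. M' \<subset> M \<longrightarrow> \<not> inconsistent M')}"

definition MSSes :: "'p form set \<Rightarrow> 'p form set set" where
  "MSSes K = {M. M \<subseteq> K \<and> \<not> inconsistent M \<and> (\<forall>\<alpha>\<in>K - M. inconsistent (M \<union> {\<alpha>}))}"

definition selfC :: "'p form set \<Rightarrow> 'p form set" where
  "selfC K = {\<alpha>\<in>K. inconsistent {\<alpha>}}"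

definition free :: "'p form set \<Rightarrow> 'p form set" where
  "free K = {\<alpha>\<in>K. \<forall>M\<in>MUSes K. \<alpha> \<notin> M}"

definition unfree :: "'p form set \<Rightarrow> 'p form set" where
  "unfree K = K - free K"

subsection \<open>The MUS-graph and the MUS-decomposition\<close>

text \<open>
  As usual in \<^theory>\<open>Graph_Theory.Graph_Theory\<close>, an undirected graph is a symmetric digraph, for
  which strongly connected components and connected components coincide.
\<close>

definition MUS_graph :: "'p form set \<Rightarrow> 'p form set pair_pre_digraph" where
  "MUS_graph K =
     \<lparr> pverts = MUSes K,
       parcs = {(M, M'). M \<in> MUSes K \<and> M' \<in> MUSes K \<and> M \<noteq> M' \<and> M \<inter> M' \<noteq> {}} \<rparr>"

lemma pair_graph_MUS_graph:
  assumes "finite K"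
  shows "pair_graph (MUS_graph K)"
proof -
  have fin: "finite (MUSes K)"
    by (rule finite_subset[of _ "Pow K"]) (use assms in \<open>auto simp: MUSes_def\<close>)
  have "finite {(M, M'). M \<in> MUSes K \<and> M' \<in> MUSes K \<and> M \<noteq> M' \<and> M \<inter> M' \<noteq> {}}"
    by (rule finite_subset[of _ "MUSes K \<times> MUSes K"]) (use fin in auto)
  with fin show ?thesis
    by unfold_locales (auto simp: MUS_graph_def symmetric_def intro!: symI)
qed

definition MUS_components :: "'p form set \<Rightarrow> 'p form set set set" where
  "MUS_components K = pre_digraph.sccs_verts (with_proj (MUS_graph K))"

definition is_MUS_decomposition :: "'p form set \<Rightarrow> 'p form set set \<Rightarrow> bool" where
  "is_MUS_decomposition K D \<longleftrightarrow>
     K = \<Union>D \<union> free K \<and> disjoint D \<and> (\<forall>L\<in>D. L \<inter> free K = {}) \<and>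
     MUSes ` D = MUS_components K"

text \<open>Existence and uniqueness are shown below.\<close>

definition MUS_decomposition :: "'p form set \<Rightarrow> 'p form set set" where
  "MUS_decomposition K = (THE D. is_MUS_decomposition K D)"

subsection \<open>The measure and ind-decomposability\<close>

definition I'_M :: "'p form set \<Rightarrow> nat" where
  "I'_M K =
     (if inconsistent K
      then (\<Sum>L\<in>MUS_decomposition K. card (MSSes L)) + card (selfC K)
      else 0)"

definition is_oplus :: "'a set \<Rightarrow> ('i \<Rightarrow> 'a set) \<Rightarrow> 'i set \<Rightarrow> bool" where
  "is_oplus C A J \<longleftrightarrow> C = (\<Union>i\<in>J. A i) \<and> disjoint_family_on A J"

definition ind_decomposable :: "'p set \<Rightarrow> ('p form set \<Rightarrow> 'v::comm_monoid_add) \<Rightarrow> bool" where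
  "ind_decomposable P I \<longleftrightarrow>
     (\<forall>(n::nat) K. n \<ge> 1 \<longrightarrow>
        (\<forall>i\<in>{1..n}. knowledge_base P (K i)) \<longrightarrow>
        is_oplus (MUSes (\<Union>i\<in>{1..n}. K i)) (\<lambda>i. MUSes (K i)) {1..n} \<longrightarrow>
        (\<forall>i\<in>{1..n}. \<forall>j\<in>{1..n}. i \<noteq> j \<longrightarrow> unfree (K i) \<inter> unfree (K j) = {}) \<longrightarrow>
        I (\<Union>i\<in>{1..n}. K i) = (\<Sum>i=1..n. I (K i)))"

subsection \<open>Well-definedness of the MUS-decomposition\<close>

primrec holds :: "('p \<Rightarrow> bool) \<Rightarrow> 'p form \<Rightarrow> bool" where
  "holds v Bot \<longleftrightarrow> False"
| "holds v (Atom p) \<longleftrightarrow> v p"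
| "holds v (Neg \<phi>) \<longleftrightarrow> \<not> holds v \<phi>"
| "holds v (Conj \<phi> \<psi>) \<longleftrightarrow> holds v \<phi> \<and> holds v \<psi>"
| "holds v (Disj \<phi> \<psi>) \<longleftrightarrow> holds v \<phi> \<or> holds v \<psi>"
| "holds v (Impl \<phi> \<psi>) \<longleftrightarrow> (holds v \<phi> \<longrightarrow> holds v \<psi>)"

lemma soundness: "\<Gamma> \<turnstile> \<phi> \<Longrightarrow> \<forall>\<gamma>\<in>\<Gamma>. holds v \<gamma> \<Longrightarrow> holds v \<phi>"
  by (induction rule: deriv.induct) auto

lemma not_inconsistent_empty: "\<not> inconsistent {}"
  using soundness[of "{}" Bot] by (auto simp: inconsistent_def)

lemma MUS_nonempty: "M \<in> MUSes K \<Longrightarrow> M \<noteq> {}"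
  using not_inconsistent_empty by (auto simp: MUSes_def)

lemma MUSes_mono: "L \<subseteq> K \<Longrightarrow> M \<in> MUSes L \<Longrightarrow> M \<in> MUSes K"
  by (auto simp: MUSes_def)

lemma sym_MUS_graph: "symmetric (with_proj (MUS_graph K))"
  by (auto simp: MUS_graph_def symmetric_def intro!: symI)

lemma reachable_MUS_graph_in_verts:
  "M \<rightarrow>\<^sup>*\<^bsub>with_proj (MUS_graph K)\<^esub> N \<Longrightarrow> M \<in> MUSes K \<and> N \<in> MUSes K"
  unfolding reachable_def
  by (induction rule: rtrancl_on.induct) (auto simp: MUS_graph_def)

lemma MUS_components_subset: "C \<in> MUS_components K \<Longrightarrow> C \<subseteq> MUSes K"
  unfolding MUS_components_def pre_digraph.sccs_verts_def
  using reachable_MUS_graph_in_verts by blast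

lemma MUS_components_nonempty: "C \<in> MUS_components K \<Longrightarrow> C \<noteq> {}"
  unfolding MUS_components_def pre_digraph.sccs_verts_def by blast

lemma MUS_components_closed:
  assumes C: "C \<in> MUS_components K" and M: "M \<in> C" and N: "N \<in> MUSes K" and "M \<inter> N \<noteq> {}"
  shows "N \<in> C"
proof (rule ccontr)
  assume "N \<notin> C"
  let ?G = "with_proj (MUS_graph K)"
  have M': "M \<in> MUSes K" using MUS_components_subset[OF C] M by blast
  have "M \<rightarrow>\<^bsub>?G\<^esub> N"
    using assms M' \<open>N \<notin> C\<close> by (auto simp: MUS_graph_def)
  then have r: "M \<rightarrow>\<^sup>*\<^bsub>?G\<^esub> N"
    using M' N by (auto simp: reachable_def MUS_graph_def intro: rtrancl_on_into_rtrancl_on)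
  then have "N \<rightarrow>\<^sup>*\<^bsub>?G\<^esub> M" by (rule symmetric_reachable[OF sym_MUS_graph])
  with r C M \<open>N \<notin> C\<close> show False
    unfolding MUS_components_def pre_digraph.sccs_verts_def by blast
qed

lemma MUS_components_cover:
  assumes "M \<in> MUSes K"
  obtains C where "C \<in> MUS_components K" "M \<in> C"
proof
  let ?G = "with_proj (MUS_graph K)"
  let ?C = "{N. M \<rightarrow>\<^sup>*\<^bsub>?G\<^esub> N}"
  have sym: "N \<rightarrow>\<^sup>*\<^bsub>?G\<^esub> N'" if "N' \<rightarrow>\<^sup>*\<^bsub>?G\<^esub> N" for N N'
    using that by (rule symmetric_reachable[OF sym_MUS_graph])
  have trans: "N \<rightarrow>\<^sup>*\<^bsub>?G\<^esub> N''" if "N \<rightarrow>\<^sup>*\<^bsub>?G\<^esub> N'" "N' \<rightarrow>\<^sup>*\<^bsub>?G\<^esub> N''" for N N' N''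
    using that unfolding reachable_def by (rule rtrancl_on_trans)
  show M: "M \<in> ?C"
    using assms by (auto simp: reachable_def MUS_graph_def)
  show "?C \<in> MUS_components K"
    unfolding MUS_components_def pre_digraph.sccs_verts_def
    using M sym trans by blast
qed

lemma MUSes_Union_component:
  assumes C: "C \<in> MUS_components K"
  shows "MUSes (\<Union>C) = C"
proof (intro equalityI subsetI)
  fix M assume M: "M \<in> MUSes (\<Union>C)"
  have "\<Union>C \<subseteq> K" using MUS_components_subset[OF C] by (auto simp: MUSes_def)
  then have MK: "M \<in> MUSes K" using M by (rule MUSes_mono)
  obtain \<alpha> where "\<alpha> \<in> M" using MUS_nonempty[OF M] by blast
  moreover have "M \<subseteq> \<Union>C" using M by (auto simp: MUSes_def)
  ultimately obtain N where "N \<in> C" "N \<inter> M \<noteq> {}" by blast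
  then show "M \<in> C" using MUS_components_closed[OF C _ MK] by blast
next
  fix M assume "M \<in> C"
  then show "M \<in> MUSes (\<Union>C)"
    using MUS_components_subset[OF C] by (auto simp: MUSes_def)
qed

lemma Union_MUSes: "\<Union>(MUSes K) = unfree K"
  by (auto simp: unfree_def free_def MUSes_def)

lemma Union_components: "\<Union>(\<Union>(MUS_components K)) = unfree K"
proof -
  have "\<Union>(MUS_components K) = MUSes K"
    using MUS_components_subset by (blast elim: MUS_components_cover)
  then show ?thesis by (simp add: Union_MUSes)
qed

theorem is_MUS_decomposition_iff:
  "is_MUS_decomposition K D \<longleftrightarrow> D = Union ` MUS_components K"
proof
  assume D: "is_MUS_decomposition K D"
  note D' = D[unfolded is_MUS_decomposition_def]
  have K: "K = \<Union>D \<union> free K" by (rule conjunct1[OF D'])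
  have dis: "disjoint D" using D' by (elim conjE)
  have free: "\<forall>L\<in>D. L \<inter> free K = {}" using D' by (elim conjE)
  have img: "MUSes ` D = MUS_components K" using D' by (elim conjE)
  have sub: "\<Union>(MUSes L) \<subseteq> L" for L :: "'a form set"
    by (auto simp: MUSes_def)
  have "\<Union>D = (\<Union>D \<union> free K) - free K"
    using free by blast
  then have UD: "\<Union>D = unfree K"
    unfolding unfree_def K[symmetric] .
  have eq: "\<Union>(MUSes L) = L" if L: "L \<in> D" for L
  proof (intro equalityI subsetI)
    fix \<alpha> assume \<alpha>: "\<alpha> \<in> L"
    then have "\<alpha> \<in> \<Union>(\<Union>(MUSes ` D))"
      using UD L unfolding img Union_components by blast
    then obtain L' where L': "L' \<in> D" "\<alpha> \<in> \<Union>(MUSes L')"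
      by auto
    then have "\<alpha> \<in> L'" using sub by blast
    then have "L' = L"
      using dis L L'(1) \<alpha> unfolding disjoint_def by blast
    with L' show "\<alpha> \<in> \<Union>(MUSes L)" by simp
  qed (use sub in blast)
  have "Union ` MUSes ` D = D"
    unfolding image_image using eq by simp
  then show "D = Union ` MUS_components K"
    unfolding img by (rule sym)
next
  assume D: "D = Union ` MUS_components K"
  have "\<Union>D = \<Union>(\<Union>(MUS_components K))"
    unfolding D by blast
  then have UD: "\<Union>D = unfree K"
    unfolding Union_components .
  have "disjoint D"
    unfolding disjoint_def D
  proof (intro ballI impI)
    fix L L' assume "L \<in> Union ` MUS_components K" "L' \<in> Union ` MUS_components K" "L \<noteq> L'"
    then obtain C C' where C: "C \<in> MUS_components K" "L = \<Union>C"
      and C': "C' \<in> MUS_components K" "L' = \<Union>C'" and ne: "C \<noteq> C'" by blast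
    show "L \<inter> L' = {}"
    proof (rule ccontr)
      assume "L \<inter> L' \<noteq> {}"
      then obtain M N where MN: "M \<in> C" "N \<in> C'" "M \<inter> N \<noteq> {}" using C C' by blast
      then have "N \<in> C"
        using MUS_components_closed[OF C(1)] MUS_components_subset[OF C'(1)] by blast
      then have "C = C'"
        using MN C(1) C'(1) unfolding MUS_components_def pre_digraph.sccs_verts_def by blast
      with ne show False ..
    qed
  qed
  moreover have "MUSes ` D = MUS_components K"
    unfolding D using MUSes_Union_component[of _ K] by (simp add: image_image)
  moreover have "\<forall>L\<in>D. L \<inter> free K = {}"
    using UD by (auto simp: unfree_def)
  moreover have "K = \<Union>D \<union> free K"
    unfolding UD by (auto simp: unfree_def free_def)
  ultimately show "is_MUS_decomposition K D"
    unfolding is_MUS_decomposition_def by (intro conjI)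
qed

lemma MUS_decomposition_eq: "MUS_decomposition K = Union ` MUS_components K"
  unfolding MUS_decomposition_def is_MUS_decomposition_iff by simp

end

theory Submission
  imports Defs
begin

text \<open>
  Every MUS of the union lies in exactly one \<^term>\<open>MUSes (K i)\<close>, and MUSes from different
  knowledge bases are disjoint because the unfree parts are. Hence no edge of the MUS-graph of the
  union joins MUSes of different \<^term>\<open>K i\<close>, so the connected components of the union are
  those of the individual knowledge bases. Self-contradictory formulae are the singleton
  MUSes, so they are partitioned as well.
\<close>

text \<open>The induction keeps \<open>\<Delta>\<close> arbitrary because the discharging rules
  extend the context. This makes inconsistency pass to supersets.\<close>

lemma deriv_weaken: "\<Gamma> \<turnstile> \<phi> \<Longrightarrow> \<Gamma> \<subseteq> \<Delta> \<Longrightarrow> \<Delta> \<turnstile> \<phi>"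
proof (induction arbitrary: \<Delta> rule: deriv.induct)
  case (Ax \<phi> \<Gamma>)
  then show ?case by (blast intro: deriv.Ax)
next
  case (Classical \<phi> \<Gamma>)
  then show ?case by (metis deriv.Classical insert_mono)
next
  case (NegI \<phi> \<Gamma>)
  then show ?case by (metis deriv.NegI insert_mono)
next
  case (NegE \<Gamma> \<phi>)
  show ?case by (rule deriv.NegE[of _ \<phi>]) (use NegE in simp_all)
next
  case (ConjI \<Gamma> \<phi> \<psi>)
  then show ?case by (simp add: deriv.ConjI)
next
  case (ConjE1 \<Gamma> \<phi> \<psi>)
  show ?case by (rule deriv.ConjE1[of _ _ \<psi>]) (use ConjE1 in simp)
next
  case (ConjE2 \<Gamma> \<phi> \<psi>)
  show ?case by (rule deriv.ConjE2[of _ \<phi>]) (use ConjE2 in simp)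
next
  case (DisjI1 \<Gamma> \<phi> \<psi>)
  then show ?case by (simp add: deriv.DisjI1)
next
  case (DisjI2 \<Gamma> \<psi> \<phi>)
  then show ?case by (simp add: deriv.DisjI2)
next
  case (DisjE \<Gamma> \<phi> \<psi> \<chi>)
  show ?case by (rule deriv.DisjE[of _ \<phi> \<psi>]) (use DisjE in \<open>simp_all add: insert_mono del: insert_subset\<close>)
next
  case (ImplI \<phi> \<Gamma> \<psi>)
  then show ?case by (metis deriv.ImplI insert_mono)
next
  case (ImplE \<Gamma> \<phi> \<psi>)
  show ?case by (rule deriv.ImplE[of _ \<phi>]) (use ImplE in simp_all)
qed

lemma MUSes_eq_empty: "\<not> inconsistent K \<Longrightarrow> MUSes K = {}"
  unfolding MUSes_def inconsistent_def using deriv_weaken by blast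

text \<open>The only proper subset of a singleton is the empty set, which is consistent by
  soundness.\<close>

lemma selfC_eq: "selfC K = {\<alpha>. {\<alpha>} \<in> MUSes K}"
  by (auto simp: selfC_def MUSes_def psubset_eq subset_singleton_iff not_inconsistent_empty)

text \<open>A consistent \<open>K\<close> has no MUS, so both summands vanish and the case
  distinction disappears.\<close>

lemma I'_M_eq: "I'_M K = (\<Sum>C\<in>MUS_components K. card (MSSes (\<Union>C))) + card (selfC K)"
proof (cases "inconsistent K")
  case True
  \<comment> \<open>On components, \<open>MUSes\<close> is a left inverse of
    \<open>Union\<close>.\<close>
  have "inj_on Union (MUS_components K)"
    by (metis inj_onI MUSes_Union_component)
  with True show ?thesis
    by (simp add: I'_M_def MUS_decomposition_eq sum.reindex)
next
  case False
  then have "MUSes K = {}"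
    by (rule MUSes_eq_empty)
  then have "MUS_components K = {}" "selfC K = {}"
    using MUS_components_subset[of _ K] MUS_components_nonempty[of _ K] by (auto simp: selfC_eq)
  with False show ?thesis
    by (simp add: I'_M_def)
qed

lemma finite_MUSes: "finite K \<Longrightarrow> finite (MUSes K)"
  by (rule finite_subset[of _ "Pow K"]) (auto simp: MUSes_def)

lemma finite_MUS_components: "finite K \<Longrightarrow> finite (MUS_components K)"
  by (rule finite_subset[of _ "Pow (MUSes K)"]) (auto simp: finite_MUSes dest: MUS_components_subset)

text \<open>By symmetry, reachability is an equivalence on the vertices. Writing its classes as an
  image of \<open>MUSes K\<close> lets a union of MUS sets distribute over the components.\<close>

lemma MUS_components_eq:
  "MUS_components K = (\<lambda>M. {N. M \<rightarrow>\<^sup>*\<^bsub>with_proj (MUS_graph K)\<^esub> N}) ` MUSes K" (is "_ = ?R ` _")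
proof -
  let ?G = "with_proj (MUS_graph K)"
  have sym: "N' \<rightarrow>\<^sup>*\<^bsub>?G\<^esub> N" if "N \<rightarrow>\<^sup>*\<^bsub>?G\<^esub> N'" for N N'
    using that by (rule symmetric_reachable[OF sym_MUS_graph])
  have R: "?R M \<in> MUS_components K \<and> M \<in> ?R M" if "M \<in> MUSes K" for M
  proof
    have trans: "N \<rightarrow>\<^sup>*\<^bsub>?G\<^esub> N''" if "N \<rightarrow>\<^sup>*\<^bsub>?G\<^esub> N'" "N' \<rightarrow>\<^sup>*\<^bsub>?G\<^esub> N''" for N N' N''
      using that unfolding reachable_def by (rule rtrancl_on_trans)
    show M: "M \<in> ?R M"
      using that by (auto simp: reachable_def MUS_graph_def)
    show "?R M \<in> MUS_components K"
      unfolding MUS_components_def pre_digraph.sccs_verts_def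
      using M sym trans by blast
  qed
  have "C \<in> ?R ` MUSes K" if C: "C \<in> MUS_components K" for C
  proof -
    obtain M where M: "M \<in> C"
      using MUS_components_nonempty[OF C] by blast
    \<comment> \<open>Mutual reachability inside \<open>C\<close> gives one inclusion, maximality of
      \<open>C\<close> together with symmetry the other.\<close>
    then have "C = ?R M"
      using C sym unfolding MUS_components_def pre_digraph.sccs_verts_def by blast
    with M MUS_components_subset[OF C] show ?thesis by blast
  qed
  moreover have "?R ` MUSes K \<subseteq> MUS_components K"
    using R by (simp add: image_subset_iff)
  ultimately show ?thesis by (meson subset_antisym subsetI)
qed

text \<open>By \<open>closed\<close>, no arc leaves \<open>MUSes L\<close>, so a path that starts
  there stays in the subgraph of \<open>L\<close>.\<close>

lemma reachable_MUS_graph_cong: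
  assumes L: "MUSes L \<subseteq> MUSes K"
    and closed: "\<And>M N. M \<in> MUSes L \<Longrightarrow> N \<in> MUSes K \<Longrightarrow> M \<inter> N \<noteq> {} \<Longrightarrow> N \<in> MUSes L"
    and M: "M \<in> MUSes L"
  shows "M \<rightarrow>\<^sup>*\<^bsub>with_proj (MUS_graph K)\<^esub> N \<longleftrightarrow> M \<rightarrow>\<^sup>*\<^bsub>with_proj (MUS_graph L)\<^esub> N"
proof
  assume "M \<rightarrow>\<^sup>*\<^bsub>with_proj (MUS_graph K)\<^esub> N"
  then show "M \<rightarrow>\<^sup>*\<^bsub>with_proj (MUS_graph L)\<^esub> N"
    unfolding reachable_def
  proof (induction rule: rtrancl_on_induct)
    case base
    show ?case using M by (auto simp: MUS_graph_def)
  next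
    case (step N N')
    \<comment> \<open>The induction hypothesis reaches \<open>N\<close> within the graph of
      \<open>L\<close>; \<open>closed\<close> then keeps its successor \<open>N'\<close>
      there.\<close>
    then have "N \<in> MUSes L"
      using reachable_MUS_graph_in_verts unfolding reachable_def by blast
    with step closed show ?case
      by (auto simp: MUS_graph_def intro!: rtrancl_on_into_rtrancl_on[where b = N])
  qed
next
  assume "M \<rightarrow>\<^sup>*\<^bsub>with_proj (MUS_graph L)\<^esub> N"
  then show "M \<rightarrow>\<^sup>*\<^bsub>with_proj (MUS_graph K)\<^esub> N"
    unfolding reachable_def
    by (rule rtrancl_on_mono[rotated 2]) (use L in \<open>auto simp: MUS_graph_def\<close>)
qed

lemma MUS_components_UN:
  assumes U: "MUSes U = (\<Union>i\<in>J. MUSes (K i))"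
    and unfree: "\<And>i j. i \<in> J \<Longrightarrow> j \<in> J \<Longrightarrow> i \<noteq> j \<Longrightarrow> unfree (K i) \<inter> unfree (K j) = {}"
  shows "MUS_components U = (\<Union>i\<in>J. MUS_components (K i))"
proof -
  \<comment> \<open>A formula shared by \<open>M\<close> and \<open>N\<close> is unfree in
    \<open>K i\<close> and in the \<open>K j\<close> that has \<open>N\<close> as a MUS, which
    forces \<open>j = i\<close>.\<close>
  have closed: "N \<in> MUSes (K i)"
    if "i \<in> J" "M \<in> MUSes (K i)" "N \<in> MUSes U" "M \<inter> N \<noteq> {}" for i M N
    using that unfree unfolding U Union_MUSes[symmetric] by blast
  have "{N. M \<rightarrow>\<^sup>*\<^bsub>with_proj (MUS_graph U)\<^esub> N} = {N. M \<rightarrow>\<^sup>*\<^bsub>with_proj (MUS_graph (K i))\<^esub> N}"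
    if "i \<in> J" "M \<in> MUSes (K i)" for i M
    using reachable_MUS_graph_cong[of "K i" U M] closed that U by blast
  then show ?thesis
    unfolding MUS_components_eq U image_UN by (intro SUP_cong image_cong) simp_all
qed

lemma I'_M_UN:
  assumes "finite J" and fin: "\<And>i. i \<in> J \<Longrightarrow> finite (K i)"
    and oplus: "is_oplus (MUSes U) (\<lambda>i. MUSes (K i)) J"
    and unfree: "\<And>i j. i \<in> J \<Longrightarrow> j \<in> J \<Longrightarrow> i \<noteq> j \<Longrightarrow> unfree (K i) \<inter> unfree (K j) = {}"
  shows "I'_M U = (\<Sum>i\<in>J. I'_M (K i))"
proof -
  have U: "MUSes U = (\<Union>i\<in>J. MUSes (K i))"
    and disj: "\<And>i j. i \<in> J \<Longrightarrow> j \<in> J \<Longrightarrow> i \<noteq> j \<Longrightarrow> MUSes (K i) \<inter> MUSes (K j) = {}"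
    using oplus by (auto simp: is_oplus_def disjoint_family_on_def)
  \<comment> \<open>A common component would be a nonempty set of common MUSes. Hence the sum over
    the union counts no component twice.\<close>
  have "MUS_components (K i) \<inter> MUS_components (K j) = {}" if "i \<in> J" "j \<in> J" "i \<noteq> j" for i j
    using disj[OF that] MUS_components_subset MUS_components_nonempty by blast
  then have comps: "(\<Sum>C\<in>MUS_components U. card (MSSes (\<Union>C)))
      = (\<Sum>i\<in>J. \<Sum>C\<in>MUS_components (K i). card (MSSes (\<Union>C)))"
    using MUS_components_UN[of U K J] U unfree \<open>finite J\<close> fin
    by (simp add: sum.UNION_disjoint finite_MUS_components)
  have "selfC U = (\<Union>i\<in>J. selfC (K i))"
    by (auto simp: selfC_eq U)
  moreover have "finite (selfC (K i))" if "i \<in> J" for i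
    using fin[OF that] by (simp add: selfC_def)
  moreover have "selfC (K i) \<inter> selfC (K j) = {}" if "i \<in> J" "j \<in> J" "i \<noteq> j" for i j
    using disj[OF that] by (auto simp: selfC_eq)
  ultimately have "card (selfC U) = (\<Sum>i\<in>J. card (selfC (K i)))"
    using \<open>finite J\<close> by (simp add: card_UN_disjoint)
  with comps show ?thesis
    by (simp add: I'_M_eq sum.distrib)
qed

theorem proposition6:
  fixes P :: "'p set"
  assumes "finite P"
  shows "ind_decomposable P (I'_M :: 'p form set \<Rightarrow> nat)"
  unfolding ind_decomposable_def
  by (intro allI impI I'_M_UN) (simp_all add: knowledge_base_def)

end
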